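(* If $r\ge 2$ and $2\le d_1 \leq \min\{d_2, \ldots, d_r\}$, then ${\rm gpack}(P_{d_1} \boxtimes \cdots \boxtimes P_{d_r}) = d_2\cdot d_3 \cdots d_r$.
   Context: $P_d$ denotes the path on $d$ vertices. The strong product $G\boxtimes H$ has vertex set $V(G)\times V(H)$, with $(g,h)$ adjacent to $(g',h')$ iff either $g=g'$ and $hh'\in E(H)$, or $h=h'$ and $gg'\in E(G)$, or $gg'\in E(G)$ and $hh'\in E(H)$. A geodesic is a shortest path; it is maximal if it is not contained as a subpath in any other geodesic. A geodesic packing of $G$ is a set of pairwise vertex-disjoint maximal geodesics of $G$, and ${\rm gpack}(G)$ is the maximum cardinality of a geodesic packing of $G$. *)

theory Defs
  imports "Graph_Theory.Graph_Theory" "HOL-Library.Sublist"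
begin

text \<open>
  A finite simple graph is represented by a loop-free symmetric digraph without parallel arcs
  (locale \<open>pair_graph\<close>): the edge \<open>uv\<close> is the pair of arcs \<open>(u, v)\<close>, \<open>(v, u)\<close>.
\<close>

definition path_graph :: "nat \<Rightarrow> nat pair_pre_digraph" where
  "path_graph d = \<lparr>pverts = {..<d}, parcs = {(i, j). i < d \<and> j < d \<and> (j = Suc i \<or> i = Suc j)}\<rparr>"

definition strong_product ::
    "'a pair_pre_digraph \<Rightarrow> 'b pair_pre_digraph \<Rightarrow> ('a \<times> 'b) pair_pre_digraph"
    (infixr \<open>\<boxtimes>\<close> 75) where
  "G \<boxtimes> H = \<lparr>pverts = pverts G \<times> pverts H,
    parcs = {((g, h), (g', h')).
      (g \<in> pverts G \<and> g = g' \<and> (h, h') \<in> parcs H) \<or>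
      (h \<in> pverts H \<and> h = h' \<and> (g, g') \<in> parcs G) \<or>
      ((g, g') \<in> parcs G \<and> (h, h') \<in> parcs H)}\<rparr>"

definition relabel :: "('a \<Rightarrow> 'b) \<Rightarrow> 'a pair_pre_digraph \<Rightarrow> 'b pair_pre_digraph" where
  "relabel f G = \<lparr>pverts = f ` pverts G, parcs = map_prod f f ` parcs G\<rparr>"

text \<open>
  The iterated product of a list of graphs. To give all these products one type, the vertex
  \<open>(x\<^sub>1, (x\<^sub>2, \<dots>))\<close> is renamed to the list \<open>[x\<^sub>1, x\<^sub>2, \<dots>]\<close>; the empty product
  is the one-vertex graph, the unit of the strong product.
\<close>

primrec strong_products :: "'a pair_pre_digraph list \<Rightarrow> 'a list pair_pre_digraph" where
  "strong_products [] = \<lparr>pverts = {[]}, parcs = {}\<rparr>"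
| "strong_products (G # Gs) = relabel (\<lambda>(x, xs). x # xs) (G \<boxtimes> strong_products Gs)"

definition geodesic :: "'a pair_pre_digraph \<Rightarrow> 'a list \<Rightarrow> bool" where
  "geodesic G p \<longleftrightarrow> vpath p G \<and>
    (\<forall>q. vpath q G \<and> hd q = hd p \<and> last q = last p \<longrightarrow> vwalk_length p \<le> vwalk_length q)"

text \<open>
  An undirected path has two traversals, \<open>p\<close> and \<open>rev p\<close>. It is a subpath of another path iff
  \<open>p\<close> is a contiguous sublist of one of the traversals of the latter, so quantifying over all lists
  \<open>q\<close> takes care of both directions. Both traversals of a path have the same vertices, so a
  packing contains at most one of them.
\<close>

definition maximal_geodesic :: "'a pair_pre_digraph \<Rightarrow> 'a list \<Rightarrow> bool" where
  "maximal_geodesic G p \<longleftrightarrow> geodesic G p \<and> \<not> (\<exists>q. geodesic G q \<and> q \<noteq> p \<and> sublist p q)"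

definition geodesic_packing :: "'a pair_pre_digraph \<Rightarrow> 'a list set \<Rightarrow> bool" where
  "geodesic_packing G S \<longleftrightarrow> (\<forall>p\<in>S. maximal_geodesic G p) \<and>
    pairwise (\<lambda>p q. set p \<inter> set q = {}) S"

definition gpack :: "'a pair_pre_digraph \<Rightarrow> nat" where
  "gpack G = Max {card S | S. geodesic_packing G S}"

lemma pair_graph_path_graph: "pair_graph (path_graph d)"
proof -
  have "finite {(i, j). i < d \<and> j < d \<and> (j = Suc i \<or> i = Suc j)}"
    by (rule finite_subset[of _ "{..<d} \<times> {..<d}"]) auto
  then show ?thesis
    by unfold_locales (auto simp: path_graph_def symmetric_def sym_def)
qed

lemma pair_graph_strong_product:
  assumes "pair_graph G" "pair_graph H"
  shows "pair_graph (G \<boxtimes> H)"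
proof -
  interpret G: pair_graph G by fact
  interpret H: pair_graph H by fact
  have wf: "parcs (G \<boxtimes> H) \<subseteq> (pverts G \<times> pverts H) \<times> (pverts G \<times> pverts H)"
    by (auto simp: strong_product_def dest: G.in_arcsD1 G.in_arcsD2 H.in_arcsD1 H.in_arcsD2)
  have verts: "pverts (G \<boxtimes> H) = pverts G \<times> pverts H"
    by (simp add: strong_product_def)
  have fin: "finite (pverts G \<times> pverts H)"
    using G.pair_finite_verts H.pair_finite_verts by simp
  have "sym (parcs G)" "sym (parcs H)"
    using G.pair_sym_arcs H.pair_sym_arcs by (simp_all add: symmetric_def)
  then have sym: "sym (parcs (G \<boxtimes> H))"
    by (auto simp: strong_product_def sym_def)
  show ?thesis
  proof unfold_locales
    show "finite (parcs (G \<boxtimes> H))" using wf fin by (meson finite_SigmaI finite_subset)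
    show "symmetric (with_proj (G \<boxtimes> H))" using sym by (simp add: symmetric_def)
    show "fst e \<noteq> snd e" if "e \<in> parcs (G \<boxtimes> H)" for e
      using that G.pair_no_loops H.pair_no_loops by (fastforce simp: strong_product_def)
  qed (use wf fin verts in auto)
qed

lemma pair_graph_relabel:
  assumes "pair_graph G" "inj f"
  shows "pair_graph (relabel f G)"
proof -
  interpret G: pair_graph G by fact
  have "sym (parcs G)" using G.pair_sym_arcs by (simp add: symmetric_def)
  then have "sym (parcs (relabel f G))"
    by (auto simp: relabel_def sym_def map_prod_def image_iff split: prod.splits) blast+
  then show ?thesis
    using G.pair_finite_verts G.pair_finite_arcs G.pair_no_loops \<open>inj f\<close>
    by unfold_locales
      (auto simp: relabel_def symmetric_def inj_eq dest: G.in_arcsD1 G.in_arcsD2)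
qed

lemma pair_graph_strong_products:
  assumes "\<And>G. G \<in> set Gs \<Longrightarrow> pair_graph G"
  shows "pair_graph (strong_products Gs)"
  using assms
proof (induction Gs)
  case Nil
  show ?case by unfold_locales (auto simp: symmetric_def sym_def)
next
  case (Cons G Gs)
  then show ?case
    by (auto intro!: pair_graph_relabel pair_graph_strong_product injI)
qed

text \<open>For finite graphs the maximum defining \<open>gpack\<close> ranges over a finite nonempty set.\<close>

lemma finite_geodesic_packings:
  assumes "finite (pverts G)"
  shows "finite {S. geodesic_packing G S}" "{} \<in> {S. geodesic_packing G S}"
proof -
  have "{p. maximal_geodesic G p} \<subseteq> {p. set p \<subseteq> pverts G \<and> distinct p}"
    by (auto simp: maximal_geodesic_def geodesic_def vpath_def vwalk_def)
  then have "finite {p. maximal_geodesic G p}"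
    using finite_subset_distinct[OF assms] by (rule finite_subset)
  then have "finite (Pow {p. maximal_geodesic G p})" by simp
  then show "finite {S. geodesic_packing G S}"
    by (rule finite_subset[rotated]) (auto simp: geodesic_packing_def)
  show "{} \<in> {S. geodesic_packing G S}" by (simp add: geodesic_packing_def)
qed

end

theory Submission
  imports Defs
begin

text \<open>
  Distance in a strong product of paths is the Chebyshev distance, so a walk is a geodesic iff
  some coordinate moves by one in the same direction at every step. A geodesic that is monotone
  in coordinate \<open>i\<close> can be prolonged unless this coordinate runs through all of \<open>P\<^bsub>d\<^sub>i\<^esub>\<close>;
  hence every maximal geodesic has at least \<open>d\<^sub>1\<close> vertices, and counting vertices gives the
  upper bound. The lines parallel to the first axis attain it: an edge of such a line changes the
  first coordinate only, so a longer geodesic would have to be monotone in that coordinate.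
\<close>

section \<open>Vertices and adjacency of the grid\<close>

abbreviation grid :: "nat list \<Rightarrow> nat list pair_pre_digraph" where
  "grid ds \<equiv> strong_products (map path_graph ds)"

lemma pverts_grid: "pverts (grid ds) = {xs. list_all2 (<) xs ds}"
proof (induction ds)
  case (Cons d ds)
  show ?case
  proof (rule set_eqI)
    fix xs
    show "xs \<in> pverts (grid (d # ds)) \<longleftrightarrow> xs \<in> {xs. list_all2 (<) xs (d # ds)}"
      by (cases xs) (auto simp: relabel_def strong_product_def path_graph_def Cons)
  qed
qed simp

lemma in_pverts_grid_iff:
  "xs \<in> pverts (grid ds) \<longleftrightarrow> length xs = length ds \<and> (\<forall>i<length ds. xs ! i < ds ! i)"
  by (auto simp: pverts_grid list_all2_conv_all_nth)

lemma card_pverts_grid: "finite (pverts (grid ds)) \<and> card (pverts (grid ds)) = prod_list ds"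
proof (induction ds)
  case (Cons d ds)
  have "inj_on (\<lambda>(x, xs). x # xs) ({..<d} \<times> pverts (grid ds))"
    by (auto simp: inj_on_def)
  moreover have "pverts (grid (d # ds)) = (\<lambda>(x, xs). x # xs) ` ({..<d} \<times> pverts (grid ds))"
    by (simp add: relabel_def strong_product_def) (simp add: path_graph_def)
  ultimately show ?case
    using Cons by (simp add: card_image del: strong_products.simps list.map)
qed simp

text \<open>Chebyshev distance at most \<open>k\<close>. The pair of additive inequalities replaces
  an absolute difference, since subtraction on \<open>nat\<close> truncates.\<close>

definition cheb_le :: "nat \<Rightarrow> nat list \<Rightarrow> nat list \<Rightarrow> bool" where
  "cheb_le k = list_all2 (\<lambda>x y. x \<le> y + k \<and> y \<le> x + k)"

lemma cheb_le_iff: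
  "cheb_le k xs ys \<longleftrightarrow> length xs = length ys \<and>
    (\<forall>i<length xs. xs ! i \<le> ys ! i + k \<and> ys ! i \<le> xs ! i + k)"
  by (simp add: cheb_le_def list_all2_conv_all_nth)

lemma path_graph_simps:
  "x \<in> pverts (path_graph d) \<longleftrightarrow> x < d"
  "(x, y) \<in> parcs (path_graph d) \<longleftrightarrow> x < d \<and> y < d \<and> (y = Suc x \<or> x = Suc y)"
  by (simp_all add: path_graph_def)

text \<open>The three cases of the strong product let each coordinate stay or move by one, as long
  as not all stay; the induction peels off the first coordinate.\<close>

lemma parcs_grid:
  "(xs, ys) \<in> parcs (grid ds) \<longleftrightarrow>
    xs \<in> pverts (grid ds) \<and> ys \<in> pverts (grid ds) \<and> xs \<noteq> ys \<and> cheb_le 1 xs ys"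
proof (induction ds arbitrary: xs ys)
  case Nil
  show ?case by auto
next
  case (Cons d ds)
  let ?P = "path_graph d" and ?G = "grid ds"
  show ?case
  proof (cases "\<exists>x xs' y ys'. xs = x # xs' \<and> ys = y # ys'")
    case True
    then obtain x xs' y ys' where eq: "xs = x # xs'" "ys = y # ys'" by blast
    have "(xs, ys) \<in> parcs (grid (d # ds)) \<longleftrightarrow> ((x, xs'), (y, ys')) \<in> parcs (?P \<boxtimes> ?G)"
      by (force simp: relabel_def eq image_iff)
    also have "\<dots> \<longleftrightarrow> xs \<in> pverts (grid (d # ds)) \<and> ys \<in> pverts (grid (d # ds)) \<and>
        xs \<noteq> ys \<and> cheb_le 1 xs ys"
    proof -
      have V: "z # zs \<in> pverts (grid (d # ds)) \<longleftrightarrow> z < d \<and> zs \<in> pverts ?G" for z zs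
        unfolding pverts_grid by simp
      have C: "cheb_le 1 xs ys \<longleftrightarrow> x \<le> Suc y \<and> y \<le> Suc x \<and> cheb_le 1 xs' ys'"
        by (simp add: eq cheb_le_def)
      \<comment> \<open>Arcs that move only the first coordinate have equal tails, which the
        induction hypothesis does not cover.\<close>
      have "cheb_le 1 zs zs" for zs by (simp add: cheb_le_iff)
      then show ?thesis
        unfolding eq V C[unfolded eq]
        by (auto simp: strong_product_def Cons path_graph_simps)
    qed
    finally show ?thesis .
  next
    case False
    then have "\<not> (xs \<in> pverts (grid (d # ds)) \<and> ys \<in> pverts (grid (d # ds)))"
      unfolding pverts_grid by (auto simp: list_all2_Cons2)
    moreover from False have "(xs, ys) \<notin> parcs (grid (d # ds))"
      by (auto simp: relabel_def)
    ultimately show ?thesis by blast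
  qed
qed

section \<open>Walks and Chebyshev distance\<close>

lemma ex_nat_split: "(\<exists>j. P j) \<longleftrightarrow> P 0 \<or> (\<exists>j. P (Suc j))"
  by (metis not0_implies_Suc)

lemma vwalk_iff_nth:
  "vwalk p (with_proj G) \<longleftrightarrow> p \<noteq> [] \<and> set p \<subseteq> pverts G \<and>
    (\<forall>j. Suc j < length p \<longrightarrow> (p ! j, p ! Suc j) \<in> parcs G)"
proof -
  have "set (vwalk_arcs p) = {(p ! j, p ! Suc j) | j. Suc j < length p}"
  proof (induction p rule: vwalk_arcs.induct)
    case (3 x y xs)
    have "e \<in> set (vwalk_arcs (x # y # xs)) \<longleftrightarrow>
      (\<exists>j. Suc j < length (x # y # xs) \<and> e = ((x # y # xs) ! j, (y # xs) ! j))" for e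
      using 3 by (subst ex_nat_split) auto
    then show ?case by auto
  qed auto
  then show ?thesis by (auto simp: vwalk_def)
qed

text \<open>One arc changes each coordinate by at most one, and these changes add up along the walk.
  This bounds the length of walks from below.\<close>

lemma vwalk_grid_cheb_le:
  assumes "vwalk p (with_proj (grid ds))" "a \<le> b" "b < length p"
  shows "cheb_le (b - a) (p ! a) (p ! b)"
  using \<open>a \<le> b\<close> \<open>b < length p\<close>
proof (induction b rule: dec_induct)
  case base
  show ?case by (simp add: cheb_le_iff)
next
  case (step b)
  then have "cheb_le (b - a) (p ! a) (p ! b)" "cheb_le 1 (p ! b) (p ! Suc b)"
    using assms(1) by (auto simp: vwalk_iff_nth parcs_grid)
  then show ?case
    using step.hyps by (fastforce simp: cheb_le_iff Suc_diff_le)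
qed

text \<open>A walk with \<open>length p\<close> vertices has \<open>length p - 1\<close> arcs, so
  this is the largest change of coordinate \<open>i\<close> that it permits. There is one equation
  per direction, again free of subtraction.\<close>

definition tight :: "nat \<Rightarrow> nat list list \<Rightarrow> bool" where
  "tight i p \<longleftrightarrow> hd p ! i + length p = Suc (last p ! i) \<or> last p ! i + length p = Suc (hd p ! i)"

text \<open>The total change leaves no slack, so every single step must change coordinate
  \<open>i\<close> by one, always in the same direction.\<close>

lemma tight_nth:
  assumes "vwalk p (with_proj (grid ds))" "i < length ds" "tight i p"
  shows "(\<forall>j<length p. p ! j ! i = hd p ! i + j) \<or> (\<forall>j<length p. p ! j ! i + j = hd p ! i)"
proof -
  have ne: "p \<noteq> []" and len: "\<And>j. j < length p \<Longrightarrow> length (p ! j) = length ds"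
    using assms(1) nth_mem by (fastforce simp: vwalk_iff_nth in_pverts_grid_iff)+
  \<comment> \<open>The distances of the \<open>j\<close>-th vertex to both ends of the walk squeeze
    its coordinate \<open>i\<close> to a single value.\<close>
  have bounds: "p ! 0 ! i \<le> p ! j ! i + j" "p ! j ! i \<le> p ! 0 ! i + j"
    "p ! j ! i \<le> p ! (length p - 1) ! i + (length p - 1 - j)"
    "p ! (length p - 1) ! i \<le> p ! j ! i + (length p - 1 - j)" if "j < length p" for j
    using that vwalk_grid_cheb_le[OF assms(1), of 0 j]
      vwalk_grid_cheb_le[OF assms(1), of j "length p - 1"] len[of 0] len[of j] assms(2)
    by (auto simp: cheb_le_iff)
  from \<open>tight i p\<close> consider
      "p ! 0 ! i + length p = Suc (p ! (length p - 1) ! i)"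
    | "p ! (length p - 1) ! i + length p = Suc (p ! 0 ! i)"
    using ne by (auto simp: tight_def hd_conv_nth last_conv_nth)
  then show ?thesis
  proof cases
    case 1
    have "p ! j ! i = hd p ! i + j" if "j < length p" for j
      using bounds[OF that] 1 that ne by (simp add: hd_conv_nth)
    then show ?thesis by blast
  next
    case 2
    have "p ! j ! i + j = hd p ! i" if "j < length p" for j
      using bounds[OF that] 2 that ne by (simp add: hd_conv_nth)
    then show ?thesis by blast
  qed
qed

section \<open>Geodesics are the walks with a tight coordinate\<close>

text \<open>Every walk between the same ends has to make the same change in coordinate
  \<open>i\<close>, hence needs at least as many arcs. No vertex repeats, because that coordinate is
  strictly monotone.\<close>

lemma tight_imp_geodesic:
  assumes walk: "vwalk p (with_proj (grid ds))" and "i < length ds" "tight i p"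
  shows "geodesic (grid ds) p"
proof -
  have "distinct p"
    using tight_nth[OF assms] by (auto simp: distinct_conv_nth) (metis add_left_cancel)+
  moreover have "length p - 1 \<le> length q - 1"
    if "vpath q (with_proj (grid ds))" "hd q = hd p" "last q = last p" for q
  proof -
    have q: "vwalk q (with_proj (grid ds))" "q \<noteq> []" using that by (auto simp: vpath_def vwalk_def)
    have "cheb_le (length q - 1) (hd q) (last q)"
      using vwalk_grid_cheb_le[OF q(1), of 0 "length q - 1"] q(2)
      by (simp add: hd_conv_nth last_conv_nth)
    moreover have "length (hd q) = length ds"
      using q by (auto simp: vwalk_iff_nth in_pverts_grid_iff subset_iff)
    ultimately show ?thesis
      using \<open>tight i p\<close> \<open>i < length ds\<close> that by (auto simp: cheb_le_iff tight_def)
  qed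
  ultimately show ?thesis
    using walk by (auto simp: geodesic_def vpath_def)
qed

text \<open>Moving all coordinates towards their targets at once reduces the Chebyshev distance by
  one per step. With \<open>vwalk_grid_cheb_le\<close>, this makes it the graph distance.\<close>

lemma ex_vwalk_grid:
  assumes "u \<in> pverts (grid ds)" "v \<in> pverts (grid ds)" "cheb_le k u v"
  shows "\<exists>p. vwalk p (with_proj (grid ds)) \<and> hd p = u \<and> last p = v \<and> length p \<le> Suc k"
  using assms(1,3)
proof (induction k arbitrary: u)
  case 0
  then have "u = v" by (auto simp: cheb_le_iff list_eq_iff_nth_eq le_antisym)
  then show ?case using 0 by (intro exI[of _ "[u]"]) (auto simp: vwalk_iff_nth)
next
  case (Suc k)
  \<comment> \<open>Each coordinate of \<open>w\<close> lies between those of \<open>u\<close> and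
    \<open>v\<close>, so \<open>w\<close> stays in the grid.\<close>
  define w where
    "w = map2 (\<lambda>x y. if x < y then Suc x else if y < x then x - 1 else x) u v"
  have len: "length u = length ds" "length v = length ds" "length w = length ds"
    using Suc.prems assms(2) by (auto simp: w_def in_pverts_grid_iff)
  have nth: "w ! i = (if u ! i < v ! i then Suc (u ! i) else if v ! i < u ! i then u ! i - 1 else u ! i)"
    if "i < length ds" for i
    using that len by (simp add: w_def)
  have w: "w \<in> pverts (grid ds)" "cheb_le k w v" "cheb_le 1 u w"
    unfolding in_pverts_grid_iff cheb_le_iff
  proof (safe, simp_all add: len)
    fix i assume i: "i < length ds"
    have "u ! i < ds ! i" "v ! i < ds ! i" "u ! i \<le> v ! i + Suc k" "v ! i \<le> u ! i + Suc k"
      using i Suc.prems assms(2) by (simp_all add: in_pverts_grid_iff cheb_le_iff)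
    then show "w ! i < ds ! i" "w ! i \<le> v ! i + k" "v ! i \<le> w ! i + k"
      "u ! i \<le> Suc (w ! i)" "w ! i \<le> Suc (u ! i)"
      unfolding nth[OF i] by auto
  qed
  then obtain p where p: "vwalk p (with_proj (grid ds))" "hd p = w" "last p = v" "length p \<le> Suc k"
    using Suc.IH by blast
  show ?case
  proof (cases "w = u")
    \<comment> \<open>There is no arc from \<open>u\<close> to itself; the walk from
      \<open>w\<close> already starts at \<open>u\<close>.\<close>
    case True
    then show ?thesis using p by (intro exI[of _ p]) auto
  next
    case False
    then have "vwalk (u # p) (with_proj (grid ds))"
      using p w Suc.prems by (intro vwalk_consI) (auto simp: parcs_grid)
    moreover have "p \<noteq> []" using p by (auto simp: vwalk_def)
    ultimately show ?thesis using p by (intro exI[of _ "u # p"]) auto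
  qed
qed

text \<open>If no coordinate changed by the full \<open>length p - 1\<close>, the ends would be
  within Chebyshev distance \<open>length p - 2\<close>, and a shorter walk would join them.\<close>

lemma geodesic_imp_tight:
  assumes "geodesic (grid ds) p" "ds \<noteq> []"
  shows "\<exists>i<length ds. tight i p"
proof (rule ccontr)
  assume not_tight: "\<not> ?thesis"
  have walk: "vwalk p (with_proj (grid ds))" and ne: "p \<noteq> []"
    using assms(1) by (auto simp: geodesic_def vpath_def vwalk_def)
  have ends: "hd p \<in> pverts (grid ds)" "last p \<in> pverts (grid ds)"
    using walk by (auto simp: vwalk_iff_nth)
  have cheb: "cheb_le (length p - 1) (hd p) (last p)"
    using vwalk_grid_cheb_le[OF walk, of 0 "length p - 1"] ne
    by (simp add: hd_conv_nth last_conv_nth)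
  \<comment> \<open>A single vertex is tight in every coordinate. Excluding it ensures that
    \<open>length p - 2\<close> does not truncate.\<close>
  have "length p \<noteq> 1"
  proof
    assume "length p = 1"
    then have "tight 0 p" by (auto simp: tight_def length_Suc_conv)
    then show False using not_tight assms(2) by auto
  qed
  then have len: "length p \<ge> 2" using ne by (cases p) (auto simp: Suc_le_eq)
  have "cheb_le (length p - 2) (hd p) (last p)"
    unfolding cheb_le_iff
  proof (intro conjI allI impI)
    show "length (hd p) = length (last p)" using cheb by (simp add: cheb_le_iff)
    fix i assume i: "i < length (hd p)"
    then have "\<not> tight i p" using not_tight ends by (auto simp: in_pverts_grid_iff)
    moreover have "hd p ! i \<le> last p ! i + (length p - 1)" "last p ! i \<le> hd p ! i + (length p - 1)"
      using cheb i by (auto simp: cheb_le_iff)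
    ultimately show "hd p ! i \<le> last p ! i + (length p - 2)" "last p ! i \<le> hd p ! i + (length p - 2)"
      using len by (auto simp: tight_def)
  qed
  then obtain q where q: "vwalk q (with_proj (grid ds))" "hd q = hd p" "last q = last p"
    "length q \<le> Suc (length p - 2)"
    using ex_vwalk_grid[OF ends] by blast
  \<comment> \<open>Geodesics are compared with paths only, so \<open>q\<close> is reduced to a
    path; its distinct vertices all occur in \<open>q\<close>, so it is no longer than
    \<open>q\<close>.\<close>
  let ?q = "vwalk_to_vpath q"
  have vp: "vpath ?q (with_proj (grid ds))" using q(1) by (rule vwalk_to_vpath_vpath)
  then have "length ?q = card (set ?q)" by (simp add: vpath_def distinct_card)
  also have "\<dots> \<le> card (set q)" by (intro card_mono) (auto dest: vwalk_to_vpath_subset)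
  also have "\<dots> \<le> length q" by (rule card_length)
  finally have "length ?q \<le> length q" .
  moreover have "length p - 1 \<le> length ?q - 1"
    using assms(1) vp q by (simp add: geodesic_def vwalk_to_vpath_hd vwalk_to_vpath_last)
  ultimately show False using q(4) len by linarith
qed

section \<open>Lengths of maximal geodesics\<close>

lemma parcs_grid_update:
  assumes "u \<in> pverts (grid ds)" "i < length ds" "y < ds ! i" "y = Suc (u ! i) \<or> u ! i = Suc y"
  shows "u[i := y] \<in> pverts (grid ds)" "(u, u[i := y]) \<in> parcs (grid ds)"
    "(u[i := y], u) \<in> parcs (grid ds)"
proof -
  have "u[i := y] ! i \<noteq> u ! i" using assms by (auto simp: in_pverts_grid_iff)
  then have "u[i := y] \<noteq> u" by metis
  then show "u[i := y] \<in> pverts (grid ds)" "(u, u[i := y]) \<in> parcs (grid ds)"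
    "(u[i := y], u) \<in> parcs (grid ds)"
    using assms by (auto simp: parcs_grid in_pverts_grid_iff cheb_le_iff nth_list_update)
qed

text \<open>At either end, one more move in the tight coordinate \<open>i\<close> alone would give a
  longer geodesic. Maximality therefore forces this coordinate to run from one border of the grid to
  the other.\<close>

lemma length_maximal_geodesic:
  assumes "maximal_geodesic (grid ds) p" "ds \<noteq> []"
  shows "length p \<in> set ds"
proof -
  have geo: "geodesic (grid ds) p"
    and max: "\<And>q. geodesic (grid ds) q \<Longrightarrow> sublist p q \<Longrightarrow> q = p"
    using assms(1) by (auto simp: maximal_geodesic_def)
  obtain i where i: "i < length ds" and tight: "tight i p"
    using geodesic_imp_tight[OF geo assms(2)] by blast
  have walk: "vwalk p (with_proj (grid ds))" and ne: "p \<noteq> []"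
    using geo by (auto simp: geodesic_def vpath_def vwalk_def)
  have ends: "hd p \<in> pverts (grid ds)" "last p \<in> pverts (grid ds)"
    using walk by (auto simp: vwalk_iff_nth)
  have len: "length (hd p) = length ds" "length (last p) = length ds"
    "hd p ! i < ds ! i" "last p ! i < ds ! i"
    using ends i by (auto simp: in_pverts_grid_iff)
  have at_hd: "\<not> tight i ((hd p)[i := y] # p)"
    if "y < ds ! i" "y = Suc (hd p ! i) \<or> hd p ! i = Suc y" for y
  proof
    note upd = parcs_grid_update[OF ends(1) i that]
    assume "tight i ((hd p)[i := y] # p)"
    moreover have "vwalk ((hd p)[i := y] # p) (with_proj (grid ds))"
      using upd walk by (intro vwalk_consI) auto
    ultimately have "geodesic (grid ds) ((hd p)[i := y] # p)"
      using tight_imp_geodesic i by blast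
    then show False using max[of "(hd p)[i := y] # p"] by (simp add: sublist_Cons_right)
  qed
  have at_last: "\<not> tight i (p @ [(last p)[i := y]])"
    if "y < ds ! i" "y = Suc (last p ! i) \<or> last p ! i = Suc y" for y
  proof
    note upd = parcs_grid_update[OF ends(2) i that]
    assume "tight i (p @ [(last p)[i := y]])"
    moreover have "vwalk (p @ [(last p)[i := y]]) (with_proj (grid ds))"
      using upd walk ne by (auto simp: vwalk_def vwalk_arcs_append)
    ultimately have "geodesic (grid ds) (p @ [(last p)[i := y]])"
      using tight_imp_geodesic i by blast
    then show False using max[of "p @ [(last p)[i := y]]"] by simp
  qed
  from tight have "length p = ds ! i"
    unfolding tight_def
  proof
    \<comment> \<open>Going up, a predecessor of the head would have coordinate one smaller and a
      successor of the last vertex one larger; \<open>at_hd\<close> and \<open>at_last\<close> put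
      both outside the grid.\<close>
    assume asc: "hd p ! i + length p = Suc (last p ! i)"
    have "hd p ! i = 0"
      using at_hd[of "hd p ! i - 1"] asc len ne i by (cases "hd p ! i") (auto simp: tight_def)
    moreover have "Suc (last p ! i) = ds ! i"
      using at_last[of "Suc (last p ! i)"] asc len ne i by (intro le_antisym) (auto simp: tight_def not_less[symmetric])
    ultimately show ?thesis using asc by simp
  next
    assume desc: "last p ! i + length p = Suc (hd p ! i)"
    have "last p ! i = 0"
      using at_last[of "last p ! i - 1"] desc len ne i by (cases "last p ! i") (auto simp: tight_def)
    moreover have "Suc (hd p ! i) = ds ! i"
      using at_hd[of "Suc (hd p ! i)"] desc len ne i by (intro le_antisym) (auto simp: tight_def not_less[symmetric])
    ultimately show ?thesis using desc by simp
  qed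
  then show ?thesis using i by simp
qed

section \<open>The packing by lines parallel to the first axis\<close>

definition axis_line :: "nat \<Rightarrow> nat list \<Rightarrow> nat list list" where
  "axis_line m xs = map (\<lambda>j. j # xs) [0..<m]"

lemma maximal_geodesic_axis_line:
  assumes "m \<ge> 2" "xs \<in> pverts (grid es)"
  shows "maximal_geodesic (grid (m # es)) (axis_line m xs)"
proof -
  let ?p = "axis_line m xs" and ?G = "grid (m # es)"
  have len: "length ?p = m" and nth: "\<And>j. j < m \<Longrightarrow> ?p ! j = j # xs"
    by (auto simp: axis_line_def)
  have ne: "?p \<noteq> []" using len assms(1) by auto
  have vert: "j # xs \<in> pverts ?G" if "j < m" for j
    using that assms(2) unfolding pverts_grid by simp
  have "vwalk ?p (with_proj ?G)"
    unfolding vwalk_iff_nth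
  proof (intro conjI allI impI)
    show "set ?p \<subseteq> pverts ?G" using vert by (auto simp: axis_line_def)
    fix j assume j: "Suc j < length ?p"
    have "cheb_le 1 (j # xs) (Suc j # xs)"
      by (auto simp: cheb_le_def intro: list.rel_refl)
    then show "(?p ! j, ?p ! Suc j) \<in> parcs ?G"
      using j vert len by (auto simp: nth parcs_grid simp del: strong_products.simps list.map)
  qed (fact ne)
  moreover have "tight 0 ?p"
    using ne assms(1) by (simp add: tight_def hd_conv_nth last_conv_nth len nth)
  ultimately have "geodesic ?G ?p"
    using tight_imp_geodesic[of ?p "m # es" 0] by simp
  moreover have False if q: "geodesic ?G q" "q \<noteq> ?p" "sublist ?p q" for q
  proof -
    obtain as bs where eq: "q = as @ ?p @ bs" using q(3) by (auto simp: sublist_def)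
    then have longer: "length q > m" using q(2) len by (cases as; cases bs) auto
    have walk: "vwalk q (with_proj ?G)" and "q \<noteq> []"
      using q(1) unfolding geodesic_def vpath_def vwalk_def by auto
    obtain i where i: "i < length (m # es)" "tight i q"
      using geodesic_imp_tight[OF q(1)] by blast
    let ?a = "length as"
    \<comment> \<open>As \<open>m \<ge> 2\<close>, the line contributes the arc from
      \<open>0 # xs\<close> to \<open>1 # xs\<close> to \<open>q\<close>. The tight coordinate of
      \<open>q\<close> changes on every arc, so it must be coordinate 0.\<close>
    have "Suc ?a < length q" using eq len assms(1) by simp
    then have "q ! ?a ! i \<noteq> q ! Suc ?a ! i"
      using tight_nth[OF walk i] by (metis Suc_lessD add_left_cancel n_not_Suc_n)
    moreover have "q ! ?a = 0 # xs" "q ! Suc ?a = 1 # xs"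
      using assms(1) by (auto simp: eq nth_append len nth)
    ultimately have "i = 0" by (cases i) auto
    moreover have "hd q ! 0 < m" "last q ! 0 < m"
    proof -
      have "set q \<subseteq> pverts ?G" using walk by (simp add: vwalk_iff_nth)
      then have "hd q \<in> pverts ?G" "last q \<in> pverts ?G" using \<open>q \<noteq> []\<close> by auto
      then show "hd q ! 0 < m" "last q ! 0 < m"
        unfolding in_pverts_grid_iff by auto
    qed
    \<comment> \<open>Coordinate 0 takes values below \<open>m\<close>, so tightness there allows at
      most \<open>m\<close> vertices.\<close>
    ultimately show False using i(2) longer by (auto simp: tight_def)
  qed
  ultimately show ?thesis unfolding maximal_geodesic_def by blast
qed

lemma geodesic_packing_axis_lines:
  assumes "m \<ge> 2"
  shows "geodesic_packing (grid (m # es)) (axis_line m ` pverts (grid es))"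
    and "card (axis_line m ` pverts (grid es)) = prod_list es"
proof -
  have "inj (axis_line m)"
  proof (rule injI)
    \<comment> \<open>The first vertex \<open>0 # xs\<close> determines \<open>xs\<close>.\<close>
    fix xs ys assume "axis_line m xs = axis_line m ys"
    then have "axis_line m xs ! 0 = axis_line m ys ! 0" by simp
    then show "xs = ys" using assms by (simp add: axis_line_def)
  qed
  then show "card (axis_line m ` pverts (grid es)) = prod_list es"
    by (metis card_image card_pverts_grid inj_on_subset subset_UNIV)
  show "geodesic_packing (grid (m # es)) (axis_line m ` pverts (grid es))"
    unfolding geodesic_packing_def
  proof
    show "\<forall>p\<in>axis_line m ` pverts (grid es). maximal_geodesic (grid (m # es)) p"
      using maximal_geodesic_axis_line[OF assms] by blast
    show "pairwise (\<lambda>p q. set p \<inter> set q = {}) (axis_line m ` pverts (grid es))"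
      by (auto simp: pairwise_def axis_line_def)
  qed
qed

section \<open>The vertex count and the value of \<open>gpack\<close>\<close>

text \<open>Each member occupies at least \<open>m\<close> vertices, because its length is a side of
  the grid and \<open>m\<close> is the smallest side. Disjoint members share the
  \<open>m * prod_list es\<close> vertices.\<close>

lemma card_geodesic_packing_le:
  assumes "geodesic_packing (grid (m # es)) S" "m > 0" "\<And>e. e \<in> set es \<Longrightarrow> m \<le> e"
  shows "card S \<le> prod_list es"
\<comment> \<open>An infinite \<open>S\<close> has \<open>card S = 0\<close>, so the bound is
  immediate there.\<close>
proof (cases "finite S")
  case True
  let ?G = "grid (m # es)"
  have p: "card (set p) \<ge> m" "set p \<subseteq> pverts ?G" if "p \<in> S" for p
  proof -
    have max: "maximal_geodesic ?G p"
      using that assms(1) unfolding geodesic_packing_def by blast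
    then have "vpath p (with_proj ?G)" unfolding maximal_geodesic_def geodesic_def by blast
    then have "distinct p" and "set p \<subseteq> pverts ?G" unfolding vpath_def vwalk_def by auto
    then show "card (set p) \<ge> m" "set p \<subseteq> pverts ?G"
      using length_maximal_geodesic[OF max] assms(3) by (auto simp: distinct_card)
  qed
  have "card S * m = (\<Sum>p\<in>S. m)" by simp
  also have "\<dots> \<le> (\<Sum>p\<in>S. card (set p))" by (intro sum_mono p(1))
  also have "\<dots> = card (\<Union>p\<in>S. set p)"
    using assms(1) True unfolding geodesic_packing_def pairwise_def
    by (intro card_UN_disjoint[symmetric]) auto
  also have "\<dots> \<le> card (pverts ?G)"
    using p(2) card_pverts_grid[of "m # es"] by (intro card_mono) blast+
  also have "\<dots> = prod_list es * m"
    using card_pverts_grid[of "m # es"] by simp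
  finally show ?thesis using \<open>m > 0\<close> by simp
qed simp

theorem gpack_grid:
  assumes "m \<ge> 2" "\<And>e. e \<in> set es \<Longrightarrow> m \<le> e"
  shows "gpack (grid (m # es)) = prod_list es"
  unfolding gpack_def
proof (rule Max_eqI)
  let ?G = "grid (m # es)"
  have "finite {S. geodesic_packing ?G S}"
    using finite_geodesic_packings(1) card_pverts_grid by blast
  then show "finite {card S | S. geodesic_packing ?G S}" by simp
  show "y \<le> prod_list es" if "y \<in> {card S | S. geodesic_packing ?G S}" for y
    using that card_geodesic_packing_le assms by fastforce
  show "prod_list es \<in> {card S | S. geodesic_packing ?G S}"
    using geodesic_packing_axis_lines[OF assms(1), of es]
    by (metis (mono_tags, lifting) mem_Collect_eq)
qed

theorem theorem4p3:
  fixes r :: nat and d :: "nat \<Rightarrow> nat"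
  assumes "r \<ge> 2"
    and "2 \<le> d 1"
    and "d 1 \<le> Min (d ` {2..r})"
  shows "gpack (strong_products (map (\<lambda>i. path_graph (d i)) [1..<r + 1])) = (\<Prod>i = 2..r. d i)"
proof -
  let ?es = "map d [2..<r + 1]"
  have "map (\<lambda>i. path_graph (d i)) [1..<r + 1] = map path_graph (d 1 # ?es)"
    using assms(1) by (simp add: upt_conv_Cons numeral_2_eq_2 del: upt_Suc)
  moreover have "d 1 \<le> e" if "e \<in> set ?es" for e
  proof -
    have "e \<in> d ` {2..r}" using that by auto
    then show ?thesis
      using assms(3) Min_le[of "d ` {2..r}" e]
      by (meson finite_atLeastAtMost finite_imageI order_trans)
  qed
  ultimately have "gpack (strong_products (map (\<lambda>i. path_graph (d i)) [1..<r + 1])) = prod_list ?es"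
    using gpack_grid[OF assms(2), of ?es] by simp
  also have "\<dots> = (\<Prod>i\<in>{2..r}. d i)"
    \<comment> \<open>The list product becomes a product over a set because the indices in
      \<open>[2..<r + 1]\<close> are distinct.\<close>
    by (simp add: prod.distinct_set_conv_list[symmetric] atLeastLessThanSuc_atLeastAtMost del: upt_Suc)
  finally show ?thesis .
qed

end
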